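(* Consider the multiple-group random coefficient regression model with $s$ groups, group sizes $n_i$, numbers of observations per unit $m_i$, regression matrices $\mathbf{G}_i$ on experimental regions $\mathcal{X}_i$, random-effects covariance matrices $\mathbf{D}_i$ and error covariance matrices $\mathbf{\Sigma}_i$, $i=1,\dots,s$. Let $\boldsymbol{\xi}^*=(\xi_1^*,\dots,\xi_s^* )$ be approximate designs with all $\mathbf{M}_i(\xi_i^* )$ non-singular, and abbreviate $$\mathbf{A}_i=\left(\mathbf{M}_i(\xi_i^* )^{-1}+\mathbf{\Delta}_i\right)^{-1},\qquad \mathbf{C}=\Big[\sum_{r=1}^s n_rm_r\left(\mathbf{M}_r(\xi_r^* )^{-1}+\mathbf{\Delta}_r\right)^{-1}\Big]^{-1}.$$ Then $\boldsymbol{\xi}^*$ is $D$-optimal for estimation of the mean parameters $\boldsymbol{\beta}_0$ if and only if $$\mathrm{tr}\left\{\tilde{\mathbf{G}}_i(x_i)\left[\mathbf{M}_i(\xi_i^* )^{-1}\mathbf{A}_i\,\mathbf{C}\,\mathbf{A}_i\,\mathbf{M}_i(\xi_i^* )^{-1}\right]\tilde{\mathbf{G}}_i(x_i)^\top\right\}\ \le\ \mathrm{tr}\left\{\mathbf{M}_i(\xi_i^* )^{-1}\mathbf{A}_i\,\mathbf{C}\,\mathbf{A}_i\right\}$$ for all $x_i\in\mathcal{X}_i$ and all $i=1,\dots,s$. Moreover, if $\boldsymbol{\xi}^*$ is $D$-optimal, then for every $i$ equality holds in this inequality at every support point $x_i$ of $\xi_i^*$.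
   Context: Model: $\mathbf{Y}_{ijh}=\mathbf{G}_i(x_{ih})\boldsymbol{\beta}_{ij}+\boldsymbol{\varepsilon}_{ijh}$, $x_{ih}\in\mathcal{X}_i$, $h=1,\dots,m_i$, $j=1,\dots,n_i$, $i=1,\dots,s$, where $n_i,m_i$ are positive integers, $\mathbf{G}_i(x)$ is a known real $l\times p$ matrix for $x\in\mathcal{X}_i$, the $p$-dimensional random parameters $\boldsymbol{\beta}_{ij}$ have unknown mean $\boldsymbol{\beta}_0$ and given ($p\times p$, positive semi-definite) covariance matrix $\mathbf{D}_i$, the errors $\boldsymbol{\varepsilon}_{ijh}$ have zero mean and non-singular $l\times l$ covariance matrix $\mathbf{\Sigma}_i$, and all random parameters and errors are uncorrelated. An approximate design $\xi_i$ in group $i$ consists of finitely many distinct points $x_{i1},\dots,x_{ik_i}\in\mathcal{X}_i$ with weights $w_{ih}\ge 0$, $\sum_{h=1}^{k_i}w_{ih}=1$; its support points are the points with positive weight. Put $\tilde{\mathbf{G}}_i=\mathbf{\Sigma}_i^{-1/2}\mathbf{G}_i$ (with $\mathbf{\Sigma}_i^{1/2}$ the symmetric positive definite square root), $$\mathbf{M}_i(\xi_i)=\sum_{h=1}^{k_i}w_{ih}\,\tilde{\mathbf{G}}_i(x_{ih})^\top\tilde{\mathbf{G}}_i(x_{ih}),\qquad \mathbf{\Delta}_i=m_i\mathbf{D}_i .$$ Only designs with all $\mathbf{M}_i(\xi_i)$ non-singular are considered (so that the best linear unbiased estimator $\hat{\boldsymbol{\beta}}_0$ exists). For these the covariance matrix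 of $\hat{\boldsymbol{\beta}}_0$ is (extended to approximate designs) $\left[\sum_{i=1}^sn_im_i(\mathbf{M}_i(\xi_i)^{-1}+\mathbf{\Delta}_i)^{-1}\right]^{-1}$, and the $D$-criterion (log-determinant of this matrix) is $$\phi_D(\xi_1,\dots,\xi_s)=-\ln\det\left(\sum_{i=1}^sn_im_i\left(\mathbf{M}_i(\xi_i)^{-1}+\mathbf{\Delta}_i\right)^{-1}\right).$$ $\boldsymbol{\xi}^*$ is $D$-optimal if it minimizes $\phi_D$ among all vectors of approximate designs $(\xi_1,\dots,\xi_s)$ with all $\mathbf{M}_i(\xi_i)$ non-singular. *)

theory Defs
  imports "HOL-Analysis.Analysis"
begin

definition pos_semidef :: "real^'n^'n \<Rightarrow> bool" where
  "pos_semidef A \<longleftrightarrow> transpose A = A \<and> (\<forall>v. 0 \<le> v \<bullet> (A *v v))"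

definition pos_def :: "real^'n^'n \<Rightarrow> bool" where
  "pos_def A \<longleftrightarrow> transpose A = A \<and> (\<forall>v. v \<noteq> 0 \<longrightarrow> 0 < v \<bullet> (A *v v))"

text \<open>The symmetric positive definite square root; meaningful only for positive definite
  arguments, where it exists and is unique.\<close>

definition mat_sqrt :: "real^'n^'n \<Rightarrow> real^'n^'n" where
  "mat_sqrt S = (THE R. pos_def R \<and> R ** R = S)"

text \<open>Design points may carry weight 0; values of the weight function outside the set of
  design points are irrelevant.\<close>

datatype 'x design = Design (points: "'x set") (weight: "'x \<Rightarrow> real")

definition approx_design :: "'x set \<Rightarrow> 'x design \<Rightarrow> bool" where
  "approx_design X \<xi> \<longleftrightarrow> finite (points \<xi>) \<and> points \<xi> \<subseteq> X \<and>
     (\<forall>x\<in>points \<xi>. 0 \<le> weight \<xi> x) \<and> (\<Sum>x\<in>points \<xi>. weight \<xi> x) = 1"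

definition support_points :: "'x design \<Rightarrow> 'x set" where
  "support_points \<xi> = {x \<in> points \<xi>. 0 < weight \<xi> x}"

definition std_regr :: "real^'l^'l \<Rightarrow> ('x \<Rightarrow> real^'p^'l) \<Rightarrow> 'x \<Rightarrow> real^'p^'l" where
  "std_regr \<Sigma> G x = matrix_inv (mat_sqrt \<Sigma>) ** G x"

definition info_matrix ::
    "real^'l^'l \<Rightarrow> ('x \<Rightarrow> real^'p^'l) \<Rightarrow> 'x design \<Rightarrow> real^'p^'p" where
  "info_matrix \<Sigma> G \<xi> =
     (\<Sum>x\<in>points \<xi>. weight \<xi> x *\<^sub>R (transpose (std_regr \<Sigma> G x) ** std_regr \<Sigma> G x))"

text \<open>In the following, the arguments of a multiple-group model are the number \<open>s\<close> of groups
  (indexed by \<open>{1..s}\<close>), the group sizes \<open>n\<close>, the numbers \<open>m\<close> of observations per unit, the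
  experimental regions \<open>X\<close>, the regression matrices \<open>G\<close>, the covariance matrices \<open>D\<close> of
  the random parameters and the covariance matrices \<open>\<Sigma>\<close> of the errors. Design vectors are
  functions of which only the components in \<open>{1..s}\<close> matter.\<close>

definition admissible ::
    "nat \<Rightarrow> (nat \<Rightarrow> 'x set) \<Rightarrow> (nat \<Rightarrow> 'x \<Rightarrow> real^'p^'l) \<Rightarrow> (nat \<Rightarrow> real^'l^'l) \<Rightarrow>
     (nat \<Rightarrow> 'x design) \<Rightarrow> bool" where
  "admissible s X G \<Sigma> \<xi> \<longleftrightarrow>
     (\<forall>i\<in>{1..s}. approx_design (X i) (\<xi> i) \<and> invertible (info_matrix (\<Sigma> i) (G i) (\<xi> i)))"

definition group_precision ::
    "nat \<Rightarrow> real^'p^'p \<Rightarrow> real^'l^'l \<Rightarrow> ('x \<Rightarrow> real^'p^'l) \<Rightarrow> 'x design \<Rightarrow> real^'p^'p" where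
  "group_precision m D \<Sigma> G \<xi> =
     matrix_inv (matrix_inv (info_matrix \<Sigma> G \<xi>) + real m *\<^sub>R D)"

text \<open>The inverse of the covariance matrix of the best linear unbiased estimator of the mean
  parameters, extended to approximate designs.\<close>

definition blue_precision ::
    "nat \<Rightarrow> (nat \<Rightarrow> nat) \<Rightarrow> (nat \<Rightarrow> nat) \<Rightarrow> (nat \<Rightarrow> 'x \<Rightarrow> real^'p^'l) \<Rightarrow>
     (nat \<Rightarrow> real^'p^'p) \<Rightarrow> (nat \<Rightarrow> real^'l^'l) \<Rightarrow> (nat \<Rightarrow> 'x design) \<Rightarrow> real^'p^'p" where
  "blue_precision s n m G D \<Sigma> \<xi> =
     (\<Sum>i=1..s. real (n i * m i) *\<^sub>R group_precision (m i) (D i) (\<Sigma> i) (G i) (\<xi> i))"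

definition D_criterion ::
    "nat \<Rightarrow> (nat \<Rightarrow> nat) \<Rightarrow> (nat \<Rightarrow> nat) \<Rightarrow> (nat \<Rightarrow> 'x \<Rightarrow> real^'p^'l) \<Rightarrow>
     (nat \<Rightarrow> real^'p^'p) \<Rightarrow> (nat \<Rightarrow> real^'l^'l) \<Rightarrow> (nat \<Rightarrow> 'x design) \<Rightarrow> real" where
  "D_criterion s n m G D \<Sigma> \<xi> = - ln (det (blue_precision s n m G D \<Sigma> \<xi>))"

definition D_optimal ::
    "nat \<Rightarrow> (nat \<Rightarrow> nat) \<Rightarrow> (nat \<Rightarrow> nat) \<Rightarrow> (nat \<Rightarrow> 'x set) \<Rightarrow>
     (nat \<Rightarrow> 'x \<Rightarrow> real^'p^'l) \<Rightarrow> (nat \<Rightarrow> real^'p^'p) \<Rightarrow> (nat \<Rightarrow> real^'l^'l) \<Rightarrow>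
     (nat \<Rightarrow> 'x design) \<Rightarrow> bool" where
  "D_optimal s n m X G D \<Sigma> \<xi> \<longleftrightarrow> admissible s X G \<Sigma> \<xi> \<and>
     (\<forall>\<eta>. admissible s X G \<Sigma> \<eta> \<longrightarrow>
        D_criterion s n m G D \<Sigma> \<xi> \<le> D_criterion s n m G D \<Sigma> \<eta>)"

end

theory Submission
  imports Defs
begin

text \<open>Two tangent inequalities replace all derivatives. First,
  \<open>det Q \<le> det P exp (tr (P\<^sup>-\<^sup>1 Q) - p)\<close> for positive definite \<open>P\<close>, by simultaneous diagonalization
  and \<open>d \<le> exp (d - 1)\<close>. Second, completing a square bounds \<open>(N\<^sup>-\<^sup>1 + \<Delta>)\<^sup>-\<^sup>1\<close> by a function that is
  affine in the information matrix \<open>N\<close> and attains the bound at a prescribed \<open>N = M\<close>. Combined at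
  \<open>\<xi>\<close>, they show that the trace condition is sufficient, since an information matrix is a convex
  combination of the matrices \<open>G(x)\<^sup>T G(x)\<close>. Combined at a design in which weight \<open>t\<close> is moved to a
  point \<open>x\<close> and evaluated at \<open>\<xi>\<close>, they show that it is necessary after letting \<open>t \<rightarrow> 0\<close>. Averaging
  over \<open>\<xi>\<^sub>i\<close> turns the condition into an equality, hence equality holds at the support points.\<close>

section \<open>Matrices, inverses and the spectral theorem\<close>

lemma bounded_bilinear_matrix_mult:
  "bounded_bilinear ((**) :: real^'n^'m \<Rightarrow> real^'p^'n \<Rightarrow> real^'p^'m)"
  unfolding bilinear_conv_bounded_bilinear[symmetric] bilinear_def
  by (auto intro!: linearI simp: matrix_matrix_mult_def vec_eq_iff algebra_simps sum.distrib sum_distrib_left)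

lemma bounded_linear_trace: "bounded_linear (trace :: real^'n^'n \<Rightarrow> real)"
  unfolding linear_conv_bounded_linear[symmetric]
  by (rule linearI) (simp_all add: trace_def sum.distrib sum_distrib_left)

lemma bounded_linear_transpose: "bounded_linear (transpose :: real^'n^'m \<Rightarrow> real^'m^'n)"
  unfolding linear_conv_bounded_linear[symmetric]
  by (rule linearI) (simp_all add: transpose_def vec_eq_iff)

lemmas matrix_mult_bilinear =
  bounded_bilinear.add_left[OF bounded_bilinear_matrix_mult]
  bounded_bilinear.add_right[OF bounded_bilinear_matrix_mult]
  bounded_bilinear.diff_left[OF bounded_bilinear_matrix_mult]
  bounded_bilinear.diff_right[OF bounded_bilinear_matrix_mult]
  bounded_bilinear.scaleR_left[OF bounded_bilinear_matrix_mult]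
  bounded_bilinear.scaleR_right[OF bounded_bilinear_matrix_mult]
  bounded_bilinear.sum_left[OF bounded_bilinear_matrix_mult]
  bounded_bilinear.sum_right[OF bounded_bilinear_matrix_mult]

lemmas trace_linear =
  linear_0[OF bounded_linear.linear[OF bounded_linear_trace]]
  linear_add[OF bounded_linear.linear[OF bounded_linear_trace]]
  linear_diff[OF bounded_linear.linear[OF bounded_linear_trace]]
  linear_cmul[OF bounded_linear.linear[OF bounded_linear_trace]]
  linear_sum[OF bounded_linear.linear[OF bounded_linear_trace]]

lemmas transpose_linear =
  linear_add[OF bounded_linear.linear[OF bounded_linear_transpose]]
  linear_diff[OF bounded_linear.linear[OF bounded_linear_transpose]]
  linear_cmul[OF bounded_linear.linear[OF bounded_linear_transpose]]
  linear_sum[OF bounded_linear.linear[OF bounded_linear_transpose]]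

lemmas tendsto_matrix_mult = bounded_bilinear.tendsto[OF bounded_bilinear_matrix_mult]

lemma inner_matrix_vector_transpose: "x \<bullet> (A *v y) = (transpose A *v x) \<bullet> y"
  for A :: "real^'n^'m"
  by (simp add: dot_lmul_matrix)

lemma matrix_inv_unique:
  fixes A B :: "real^'n^'n"
  assumes "A ** B = mat 1"
  shows "matrix_inv A = B"
proof -
  have "invertible A"
    using assms matrix_left_right_inverse unfolding invertible_def by blast
  then have "matrix_inv A ** A = mat 1"
    unfolding invertible_def matrix_inv_def by (rule someI2_ex) auto
  then have "matrix_inv A ** A ** B = B" by simp
  with assms show ?thesis by (simp add: matrix_mul_assoc[symmetric])
qed

lemma
  fixes A :: "real^'n^'n"
  assumes "invertible A"
  shows matrix_inv_left: "matrix_inv A ** A = mat 1"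
    and matrix_inv_right: "A ** matrix_inv A = mat 1"
    and matrix_inv_matrix_inv: "matrix_inv (matrix_inv A) = A"
    and invertible_matrix_inv: "invertible (matrix_inv A)"
proof -
  obtain B where B: "A ** B = mat 1" "B ** A = mat 1"
    using assms unfolding invertible_def by blast
  have "matrix_inv A = B" by (rule matrix_inv_unique[OF B(1)])
  with B show "matrix_inv A ** A = mat 1" "A ** matrix_inv A = mat 1"
    "matrix_inv (matrix_inv A) = A" "invertible (matrix_inv A)"
    by (auto intro: matrix_inv_unique simp: invertible_def)
qed

lemma transpose_matrix_inv:
  fixes A :: "real^'n^'n"
  assumes "invertible A"
  shows "transpose (matrix_inv A) = matrix_inv (transpose A)"
proof -
  have "transpose A ** transpose (matrix_inv A) = mat 1"
    by (simp add: matrix_transpose_mul[symmetric] matrix_inv_left assms)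
  then show ?thesis by (rule matrix_inv_unique[symmetric])
qed

section \<open>Continuity of the determinant and of matrix inversion\<close>

lemma tendsto_det:
  fixes F :: "'a \<Rightarrow> real^'n^'n"
  assumes "(F \<longlongrightarrow> L) net"
  shows "((\<lambda>t. det (F t)) \<longlongrightarrow> det L) net"
  unfolding det_def by (intro tendsto_intros assms)

lemma matrix_inv_cramer:
  fixes A :: "real^'n^'n"
  assumes "invertible A"
  shows "matrix_inv A $ i $ j = det (\<chi> k l. if l = i then axis j 1 $ k else A $ k $ l) / det A"
proof -
  have "A *v (matrix_inv A *v axis j 1) = axis j 1"
    by (simp add: matrix_vector_mul_assoc matrix_inv_right assms)
  moreover have "det A \<noteq> 0" using assms by (simp add: invertible_det_nz)
  ultimately have "matrix_inv A *v axis j 1 =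
      (\<chi> i. det (\<chi> k l. if l = i then axis j 1 $ k else A $ k $ l) / det A)"
    by (simp add: cramer)
  then have "(matrix_inv A *v axis j 1) $ i =
      det (\<chi> k l. if l = i then axis j 1 $ k else A $ k $ l) / det A"
    by simp
  then show ?thesis by (simp add: matrix_vector_mult_basis column_def)
qed

text \<open>By Cramer's rule every entry of an inverse is a quotient of determinants. The formula
  describes \<open>matrix_inv (F t)\<close> only where \<open>F t\<close> is invertible; since
  \<open>det L\<close> is nonzero this holds eventually, which is enough for the limit.\<close>

lemma tendsto_matrix_inv:
  fixes F :: "'a \<Rightarrow> real^'n^'n"
  assumes F: "(F \<longlongrightarrow> L) net" and L: "invertible L"
  shows "((\<lambda>t. matrix_inv (F t)) \<longlongrightarrow> matrix_inv L) net"
proof -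
  have L0: "det L \<noteq> 0" using L by (simp add: invertible_det_nz)
  have "eventually (\<lambda>t. det (F t) \<noteq> 0) net"
    using tendsto_imp_eventually_ne[OF tendsto_det[OF F] L0] .
  then have ev: "eventually (\<lambda>t. invertible (F t)) net"
    by (simp add: invertible_det_nz)
  have "((\<lambda>t. matrix_inv (F t) $ i $ j) \<longlongrightarrow> matrix_inv L $ i $ j) net" for i j
  proof -
    have "((\<lambda>t. if l = i then axis j 1 $ k else F t $ k $ l) \<longlongrightarrow>
        (if l = i then axis j 1 $ k else L $ k $ l)) net" for k l
      by (cases "l = i") (auto intro!: tendsto_intros F)
    then have "((\<lambda>t. det (\<chi> k l. if l = i then axis j 1 $ k else F t $ k $ l) / det (F t)) \<longlongrightarrow>
        det (\<chi> k l. if l = i then axis j 1 $ k else L $ k $ l) / det L) net"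
      by (intro tendsto_divide tendsto_det F L0 tendsto_vec_lambda)
    then show ?thesis
      unfolding matrix_inv_cramer[OF L, symmetric]
      by (rule Lim_transform_eventually)
        (use ev in \<open>auto elim!: eventually_mono simp: matrix_inv_cramer\<close>)
  qed
  then show ?thesis by (intro vec_tendstoI)
qed

section \<open>Spectral theorem for real symmetric matrices\<close>

definition diag_matrix :: "('n \<Rightarrow> real) \<Rightarrow> real^'n^'n" where
  "diag_matrix d = (\<chi> i j. if i = j then d i else 0)"

text \<open>The eigenvector maximizes the Rayleigh quotient over the unit sphere of the orthogonal
  complement \<open>V\<close> of \<open>B\<close>. Because \<open>B\<close> consists of eigenvectors
  and \<open>S\<close> is symmetric, \<open>S\<close> maps \<open>V\<close> into itself, so the
  residual \<open>r = S u - c u\<close> is an admissible direction of ascent and must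
  vanish.\<close>

lemma symmetric_matrix_eigenvector_in_orthogonal_complement:
  fixes S :: "real^'n^'n"
  assumes S: "transpose S = S" and "finite B" "card B < CARD('n)"
    and B: "\<And>b. b \<in> B \<Longrightarrow> \<exists>c. S *v b = c *\<^sub>R b"
  obtains u c where "norm u = 1" "S *v u = c *\<^sub>R u" "\<And>b. b \<in> B \<Longrightarrow> orthogonal b u"
proof -
  define V where "V = {v. \<forall>b\<in>B. b \<bullet> v = 0}"
  define q where "q v w = v \<bullet> (S *v w)" for v w
  have V_eq: "V = (\<Inter>b\<in>B. {v. b \<bullet> v = 0})" by (auto simp: V_def)
  have V: "subspace V" "closed V"
    unfolding V_eq by (auto intro!: subspace_Int closed_INT subspace_hyperplane closed_hyperplane)
  have q_sym: "q v w = q w v" for v w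
    unfolding q_def by (metis S inner_commute inner_matrix_vector_transpose)
  have SV: "S *v v \<in> V" if "v \<in> V" for v
  proof -
    have "b \<bullet> (S *v v) = 0" if "b \<in> B" for b
    proof -
      obtain c where "S *v b = c *\<^sub>R b" using B \<open>b \<in> B\<close> by blast
      moreover have "b \<bullet> (S *v v) = v \<bullet> (S *v b)"
        using q_sym unfolding q_def .
      ultimately show ?thesis
        using \<open>v \<in> V\<close> \<open>b \<in> B\<close> by (simp add: V_def inner_commute)
    qed
    then show ?thesis by (simp add: V_def)
  qed
  have "dim B < DIM(real^'n)"
    using dim_le_card'[OF \<open>finite B\<close>] \<open>card B < _\<close> by simp
  then obtain x where "x \<noteq> 0" and x: "\<And>y. y \<in> span B \<Longrightarrow> orthogonal x y"
    using orthogonal_to_subspace_exists by blast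
  have "x \<in> V"
    using x by (auto simp: V_def orthogonal_def inner_commute span_base)
  then have "x /\<^sub>R norm x \<in> V" using V(1) by (simp add: subspace_scale)
  then have ne: "V \<inter> sphere 0 1 \<noteq> {}" using \<open>x \<noteq> 0\<close> by auto
  have cpt: "compact (V \<inter> sphere 0 1)" using V(2) by (simp add: closed_Int_compact)
  have "continuous_on (V \<inter> sphere 0 1) (\<lambda>v. q v v)"
    unfolding q_def by (intro continuous_intros linear_continuous_on matrix_vector_mul_bounded_linear)
  then obtain u where u: "u \<in> V" "norm u = 1"
    and umax: "\<And>v. v \<in> V \<Longrightarrow> norm v = 1 \<Longrightarrow> q v v \<le> q u u"
    using continuous_attains_sup[OF cpt ne, of "\<lambda>v. q v v"] by auto
  define c where "c = q u u"
  have le: "q v v \<le> c * (v \<bullet> v)" if "v \<in> V" for v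
  proof (cases "v = 0")
    case False
    have "q (v /\<^sub>R norm v) (v /\<^sub>R norm v) \<le> c"
      unfolding c_def using False that V(1) by (intro umax) (auto simp: subspace_scale)
    moreover have "q (v /\<^sub>R norm v) (v /\<^sub>R norm v) = q v v / (v \<bullet> v)"
      by (simp add: q_def matrix_vector_mult_scaleR dot_square_norm power2_eq_square divide_simps)
    ultimately have "q v v / (v \<bullet> v) \<le> c" by simp
    then show ?thesis using False by (simp add: pos_divide_le_eq)
  qed (simp add: q_def)
  define r where "r = S *v u - c *\<^sub>R u"
  have "r \<in> V" unfolding r_def using V(1) SV u(1) by (simp add: subspace_diff subspace_scale)
  define k where "k = c * (r \<bullet> r) - q r r"
  have "k \<ge> 0" using le[OF \<open>r \<in> V\<close>] by (simp add: k_def)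
  \<comment> \<open>A step length with \<open>t * k \<le> r \<bullet> r\<close>; the summand 1 keeps
    the denominator positive when \<open>k = 0\<close>. Maximality at \<open>u + t r\<close> would
    require \<open>2 * (r \<bullet> r) \<le> t * k\<close>.\<close>
  define t where "t = (r \<bullet> r) / (k + 1)"
  have "r = 0"
  proof (rule ccontr)
    assume "r \<noteq> 0"
    then have rr: "r \<bullet> r > 0" by simp
    then have "t > 0" using \<open>k \<ge> 0\<close> by (simp add: t_def)
    have uu: "u \<bullet> u = 1" using u(2) by (simp add: dot_square_norm)
    have qru: "q r u = r \<bullet> r + c * (r \<bullet> u)"
      unfolding q_def r_def by (simp add: algebra_simps inner_diff_left inner_diff_right)
    define w where "w = u + t *\<^sub>R r"
    have qw: "q w w = q u u + 2 * t * q r u + t^2 * q r r"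
      using q_sym[of u r]
      by (simp add: w_def q_def matrix_vector_right_distrib matrix_vector_mult_scaleR inner_add_left
          inner_add_right power2_eq_square algebra_simps)
    have ww: "w \<bullet> w = 1 + 2 * t * (r \<bullet> u) + t^2 * (r \<bullet> r)"
      using uu by (simp add: w_def inner_add_left inner_add_right power2_eq_square inner_commute algebra_simps)
    have "q w w \<le> c * (w \<bullet> w)"
      unfolding w_def using V(1) u(1) \<open>r \<in> V\<close> by (intro le) (simp add: subspace_add subspace_scale)
    then have "0 \<le> t * (t * k - 2 * (r \<bullet> r))"
      unfolding qw ww qru c_def[symmetric] k_def by (simp add: algebra_simps power2_eq_square)
    then have "2 * (r \<bullet> r) \<le> t * k" using \<open>t > 0\<close> by (simp add: zero_le_mult_iff)
    also have "t * k \<le> r \<bullet> r"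
      using \<open>k \<ge> 0\<close> rr by (simp add: t_def divide_simps)
    finally show False using rr by simp
  qed
  then have "S *v u = c *\<^sub>R u" by (simp add: r_def)
  with u show ?thesis by (intro that) (auto simp: V_def orthogonal_def)
qed

lemma symmetric_matrix_eigenvector_set:
  fixes S :: "real^'n^'n"
  assumes S: "transpose S = S" and "k \<le> CARD('n)"
  shows "\<exists>B. finite B \<and> card B = k \<and> pairwise orthogonal B \<and>
    (\<forall>b\<in>B. norm b = 1 \<and> (\<exists>c. S *v b = c *\<^sub>R b))"
  using \<open>k \<le> _\<close>
proof (induction k)
  case 0
  show ?case by (intro exI[of _ "{}"]) auto
next
  case (Suc k)
  then obtain B where B: "finite B" "card B = k" "pairwise orthogonal B"
    "\<forall>b\<in>B. norm b = 1 \<and> (\<exists>c. S *v b = c *\<^sub>R b)" by auto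
  obtain u c where u: "norm u = 1" "S *v u = c *\<^sub>R u" "\<And>b. b \<in> B \<Longrightarrow> orthogonal b u"
    by (rule symmetric_matrix_eigenvector_in_orthogonal_complement[OF S B(1)]) (use B Suc.prems in auto)
  have "u \<notin> B" using u(1) u(3)[of u] by (auto simp: orthogonal_self)
  then show ?case
    using B u by (intro exI[of _ "insert u B"])
      (auto simp: pairwise_insert orthogonal_commute)
qed

text \<open>A set of \<open>CARD('n)\<close> orthonormal eigenvectors is in bijection with the index
  type and supplies the columns of \<open>U\<close>.\<close>

theorem symmetric_matrix_diagonalization:
  fixes S :: "real^'n^'n"
  assumes S: "transpose S = S"
  obtains U :: "real^'n^'n" and d where "orthogonal_matrix U" "transpose U ** S ** U = diag_matrix d"
proof -
  obtain B where B: "finite B" "card B = CARD('n)" "pairwise orthogonal B"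
    "\<forall>b\<in>B. norm b = 1 \<and> (\<exists>c. S *v b = c *\<^sub>R b)"
    using symmetric_matrix_eigenvector_set[OF S order_refl] by blast
  obtain e :: "'n \<Rightarrow> real^'n" where e: "bij_betw e UNIV B"
    using finite_same_card_bij[of "UNIV :: 'n set" B] B by auto
  have eB: "e j \<in> B" for j using e by (auto simp: bij_betw_def)
  then have "\<forall>j. \<exists>c. S *v e j = c *\<^sub>R e j" using B(4) by blast
  from choice[OF this] obtain d where d: "S *v e j = d j *\<^sub>R e j" for j by blast
  have ee: "e i \<bullet> e j = (if i = j then 1 else 0)" for i j
  proof (cases "i = j")
    case True
    then show ?thesis using B(4) eB by (simp add: dot_square_norm)
  next
    case False
    then have "e i \<noteq> e j" using e by (auto simp: bij_betw_def inj_on_def)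
    then show ?thesis using False B(3) eB by (auto simp: pairwise_def orthogonal_def)
  qed
  define U :: "real^'n^'n" where "U = (\<chi> i j. e j $ i)"
  have colU: "column j U = e j" for j by (simp add: U_def column_def vec_eq_iff)
  have UtU: "(transpose U ** W) $ i $ j = e i \<bullet> column j W" for W :: "real^'n^'n" and i j
    by (simp add: U_def matrix_matrix_mult_def transpose_def inner_vec_def column_def)
  have "transpose U ** U = mat 1"
    by (simp add: vec_eq_iff UtU colU ee mat_def)
  moreover have colSU: "column j (S ** U) = d j *\<^sub>R e j" for j
    unfolding d[symmetric]
    by (simp add: column_def vec_eq_iff matrix_matrix_mult_def matrix_vector_mult_def U_def)
  have "transpose U ** (S ** U) = diag_matrix d"
    by (simp add: vec_eq_iff UtU colSU ee diag_matrix_def)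
  ultimately show ?thesis
    by (intro that[of U d]) (auto simp: orthogonal_matrix matrix_mul_assoc)
qed

section \<open>Positive definite matrices\<close>

lemma diag_matrix_mult: "diag_matrix a ** diag_matrix b = diag_matrix (\<lambda>i. a i * b i)"
proof -
  have "(\<Sum>k\<in>UNIV. (if i = k then a i else 0) * (if k = j then b k else 0)) =
      (if i = j then a i * b i else 0)" for i j
    by (subst sum.mono_neutral_right[where S = "{i}"]) auto
  then show ?thesis by (simp add: diag_matrix_def matrix_matrix_mult_def vec_eq_iff)
qed

lemma diag_matrix_const_1: "diag_matrix (\<lambda>i. 1) = mat 1"
  by (simp add: diag_matrix_def mat_def)

lemma transpose_diag_matrix: "transpose (diag_matrix d) = diag_matrix d"
  by (auto simp: diag_matrix_def transpose_def vec_eq_iff)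

lemma trace_diag_matrix: "trace (diag_matrix d) = (\<Sum>i\<in>UNIV. d i)"
  by (simp add: diag_matrix_def trace_def)

lemma det_diag_matrix: "det (diag_matrix d) = (\<Prod>i\<in>UNIV. d i)"
  by (subst det_diagonal) (simp_all add: diag_matrix_def)

lemma diag_matrix_nth_diag: "diag_matrix d $ i $ i = d i"
  by (simp add: diag_matrix_def)

lemma pos_def_transpose: "pos_def P \<Longrightarrow> transpose P = P"
  by (simp add: pos_def_def)

lemma pos_semidef_transpose: "pos_semidef P \<Longrightarrow> transpose P = P"
  by (simp add: pos_semidef_def)

lemma quadratic_form_congruence:
  fixes T :: "real^'n^'m"
  shows "v \<bullet> ((transpose T ** S ** T) *v v) = (T *v v) \<bullet> (S *v (T *v v))"
  by (simp only: matrix_vector_mul_assoc[symmetric] inner_matrix_vector_transpose[of v "transpose T"]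
      transpose_transpose)

lemma transpose_congruence:
  fixes T :: "real^'n^'m"
  assumes "transpose S = S"
  shows "transpose (transpose T ** S ** T) = transpose T ** S ** T"
  by (simp add: matrix_transpose_mul assms matrix_mul_assoc)

lemma pos_semidef_congruence:
  fixes T :: "real^'n^'m"
  assumes "pos_semidef S"
  shows "pos_semidef (transpose T ** S ** T)"
  using assms unfolding pos_semidef_def
  by (simp add: transpose_congruence quadratic_form_congruence del: transpose_matrix_vector)

lemma diagonal_entry_eq_quadratic_form: "A $ i $ i = axis i 1 \<bullet> (A *v axis i (1::real))"
  by (simp add: inner_axis' matrix_vector_mult_basis column_def)

lemma pos_semidef_diagonal_nonneg: "pos_semidef A \<Longrightarrow> 0 \<le> A $ i $ i"
  by (simp add: diagonal_entry_eq_quadratic_form pos_semidef_def)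

lemma pos_def_imp_pos_semidef: "pos_def P \<Longrightarrow> pos_semidef P"
  unfolding pos_def_def pos_semidef_def by (metis inner_zero_left order.order_iff_strict)

text \<open>First diagonalize \<open>P\<close> orthogonally and rescale by the inverse square roots
  of its eigenvalues, which turns \<open>P\<close> into the identity. A further orthogonal change of
  basis diagonalizes the transformed \<open>Q\<close> and leaves the identity alone.\<close>

theorem simultaneous_diagonalization:
  fixes P Q :: "real^'n^'n"
  assumes P: "pos_def P" and Q: "transpose Q = Q"
  obtains T :: "real^'n^'n" and d where "transpose T ** P ** T = mat 1" "transpose T ** Q ** T = diag_matrix d"
proof -
  obtain U e where U: "orthogonal_matrix U" and e: "transpose U ** P ** U = diag_matrix e"
    using symmetric_matrix_diagonalization[OF pos_def_transpose[OF P]] by blast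
  have e_pos: "e i > 0" for i
  proof -
    have "e i = (U *v axis i 1) \<bullet> (P *v (U *v axis i 1))"
      unfolding quadratic_form_congruence[symmetric] e diagonal_entry_eq_quadratic_form[symmetric]
      by (simp add: diag_matrix_nth_diag)
    moreover have "U *v axis i 1 \<noteq> 0"
    proof
      assume "U *v axis i 1 = 0"
      then have "transpose U *v (U *v axis i 1) = 0" by simp
      then have "axis i (1::real) = 0"
        unfolding matrix_vector_mul_assoc using U by (simp add: orthogonal_matrix)
      then show False by (simp add: axis_eq_0_iff)
    qed
    ultimately show ?thesis using P by (simp add: pos_def_def)
  qed
  define R where "R = diag_matrix (\<lambda>i. 1 / sqrt (e i))"
  define T0 where "T0 = U ** R"
  have "transpose T0 ** P ** T0 = R ** (transpose U ** P ** U) ** R"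
    by (simp add: T0_def R_def matrix_transpose_mul transpose_diag_matrix matrix_mul_assoc)
  also have "\<dots> = diag_matrix (\<lambda>i. 1 / sqrt (e i) * e i * (1 / sqrt (e i)))"
    by (simp add: e R_def diag_matrix_mult)
  also have "(\<lambda>i. 1 / sqrt (e i) * e i * (1 / sqrt (e i))) = (\<lambda>i. 1)"
    using e_pos by (simp add: less_imp_neq[THEN not_sym] less_imp_le)
  finally have T0: "transpose T0 ** P ** T0 = mat 1" by (simp add: diag_matrix_const_1)
  obtain V d where V: "orthogonal_matrix V"
    and d: "transpose V ** (transpose T0 ** Q ** T0) ** V = diag_matrix d"
    using symmetric_matrix_diagonalization[OF transpose_congruence[OF Q, of T0]] by blast
  have "transpose (T0 ** V) ** P ** (T0 ** V) = transpose V ** (transpose T0 ** P ** T0) ** V"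
    by (simp add: matrix_transpose_mul matrix_mul_assoc)
  also have "\<dots> = mat 1" using V by (simp add: T0 orthogonal_matrix)
  finally have 1: "transpose (T0 ** V) ** P ** (T0 ** V) = mat 1" .
  have "transpose (T0 ** V) ** Q ** (T0 ** V) = transpose V ** (transpose T0 ** Q ** T0) ** V"
    by (simp add: matrix_transpose_mul matrix_mul_assoc)
  with d 1 show ?thesis by (intro that) auto
qed

lemma matrix_inv_of_congruence_to_identity:
  fixes P T :: "real^'n^'n"
  assumes "transpose T ** P ** T = mat 1"
  shows "invertible P" "matrix_inv P = T ** transpose T"
proof -
  have "T ** (transpose T ** P) = mat 1"
    using assms matrix_left_right_inverse by blast
  then have 1: "(T ** transpose T) ** P = mat 1" by (simp add: matrix_mul_assoc)
  then have 2: "P ** (T ** transpose T) = mat 1" using matrix_left_right_inverse by blast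
  from 1 2 show "invertible P" unfolding invertible_def by blast
  show "matrix_inv P = T ** transpose T" by (rule matrix_inv_unique[OF 2])
qed

lemma pos_def_invertible: "pos_def P \<Longrightarrow> invertible P"
  by (metis simultaneous_diagonalization matrix_inv_of_congruence_to_identity(1) pos_def_transpose)

text \<open>For nonzero \<open>v\<close> invertibility makes \<open>w = P v\<close> nonzero. Moving
  from \<open>v\<close> a little in direction \<open>- w\<close> strictly lowers the quadratic form,
  which stays nonnegative, so its value at \<open>v\<close> was positive.\<close>

lemma pos_semidef_invertible_imp_pos_def:
  fixes P :: "real^'n^'n"
  assumes P: "pos_semidef P" and "invertible P"
  shows "pos_def P"
proof -
  have "0 < v \<bullet> (P *v v)" if "v \<noteq> 0" for v
  proof -
    define w where "w = P *v v"
    have Psym: "transpose P = P" using P by (rule pos_semidef_transpose)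
    have "w \<noteq> 0"
    proof
      assume "w = 0"
      then have "matrix_inv P *v (P *v v) = 0" by (simp add: w_def)
      then show False
        using that unfolding matrix_vector_mul_assoc by (simp add: matrix_inv_left assms)
    qed
    define c where "c = w \<bullet> (P *v w)"
    have "c \<ge> 0" using P by (simp add: c_def pos_semidef_def)
    define t where "t = (w \<bullet> w) / (c + 1)"
    have ww: "w \<bullet> w > 0" using \<open>w \<noteq> 0\<close> by simp
    then have "t > 0" using \<open>c \<ge> 0\<close> by (simp add: t_def)
    have "v \<bullet> (P *v w) = w \<bullet> w"
      using inner_matrix_vector_transpose[of v P w] unfolding Psym by (simp add: w_def)
    then have "(v - t *\<^sub>R w) \<bullet> (P *v (v - t *\<^sub>R w)) = v \<bullet> (P *v v) - t * (2 * (w \<bullet> w) - t * c)"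
      by (simp add: matrix_vector_mult_diff_distrib matrix_vector_mult_scaleR inner_diff_left
          inner_diff_right w_def[symmetric] c_def algebra_simps)
    moreover have "0 \<le> (v - t *\<^sub>R w) \<bullet> (P *v (v - t *\<^sub>R w))"
      using P by (simp add: pos_semidef_def)
    moreover have "t * c \<le> w \<bullet> w"
      using \<open>c \<ge> 0\<close> ww by (simp add: t_def divide_simps)
    then have "0 < t * (2 * (w \<bullet> w) - t * c)"
      using ww \<open>t > 0\<close> by (intro mult_pos_pos) linarith+
    ultimately show ?thesis by linarith
  qed
  with P show ?thesis by (simp add: pos_def_def pos_semidef_def)
qed

lemma pos_def_matrix_inv:
  fixes P :: "real^'n^'n"
  assumes P: "pos_def P"
  shows "pos_def (matrix_inv P)"
proof (rule pos_semidef_invertible_imp_pos_def)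
  have inv: "invertible P" using P by (rule pos_def_invertible)
  have "transpose (matrix_inv P) ** P ** matrix_inv P = matrix_inv P"
    by (simp add: transpose_matrix_inv inv pos_def_transpose[OF P] matrix_inv_left)
  then show "pos_semidef (matrix_inv P)"
    by (metis pos_semidef_congruence pos_def_imp_pos_semidef P)
  show "invertible (matrix_inv P)" using inv by (rule invertible_matrix_inv)
qed

lemma pos_semidef_add: "pos_semidef P \<Longrightarrow> pos_semidef Q \<Longrightarrow> pos_semidef (P + Q)"
  by (simp add: pos_semidef_def transpose_linear matrix_vector_mult_add_rdistrib inner_add_right)

lemma pos_semidef_scaleR: "0 \<le> c \<Longrightarrow> pos_semidef P \<Longrightarrow> pos_semidef (c *\<^sub>R P)"
  by (simp add: pos_semidef_def transpose_linear scaleR_matrix_vector_assoc[symmetric])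

lemma pos_semidef_0: "pos_semidef 0"
  by (simp add: pos_semidef_def transpose_def vec_eq_iff)

lemma pos_semidef_sum: "(\<And>i. i \<in> I \<Longrightarrow> pos_semidef (P i)) \<Longrightarrow> pos_semidef (sum P I)"
  by (induction I rule: infinite_finite_induct) (auto simp: pos_semidef_0 pos_semidef_add)

lemma pos_def_add_pos_semidef: "pos_def P \<Longrightarrow> pos_semidef Q \<Longrightarrow> pos_def (P + Q)"
  by (simp add: pos_semidef_def pos_def_def transpose_linear matrix_vector_mult_add_rdistrib
      inner_add_right add_pos_nonneg)

lemma pos_def_scaleR: "0 < c \<Longrightarrow> pos_def P \<Longrightarrow> pos_def (c *\<^sub>R P)"
  by (simp add: pos_def_def transpose_linear scaleR_matrix_vector_assoc[symmetric])

lemma pos_def_sum: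
  assumes "finite I" "I \<noteq> {}" "\<And>i. i \<in> I \<Longrightarrow> pos_def (P i)"
  shows "pos_def (sum P I)"
proof -
  obtain i where i: "i \<in> I" using assms by blast
  have "pos_semidef (sum P (I - {i}))"
    using assms by (intro pos_semidef_sum pos_def_imp_pos_semidef) auto
  then show ?thesis
    using assms i pos_def_add_pos_semidef by (metis sum.remove)
qed

lemma pos_semidef_gram: "pos_semidef (transpose G ** G)" for G :: "real^'n^'m"
proof -
  have "pos_semidef (mat 1 :: real^'m^'m)" by (simp add: pos_semidef_def)
  from pos_semidef_congruence[OF this, of G] show ?thesis by simp
qed

text \<open>The numbers \<open>d i\<close> are the eigenvalues of \<open>matrix_inv P ** Q\<close>:
  their sum is its trace, and their product is \<open>det Q * (det T)\<^sup>2\<close>, where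
  \<open>(det T)\<^sup>2\<close> is the reciprocal of \<open>det P\<close>. Semidefiniteness of
  \<open>Q\<close> makes them nonnegative, so the scalar bounds may be multiplied.\<close>

lemma
  fixes P Q :: "real^'n^'n"
  assumes P: "pos_def P" and Q: "pos_semidef Q"
  shows trace_matrix_inv_mult_nonneg: "0 \<le> trace (matrix_inv P ** Q)"
    and det_pos_def: "0 < det P"
    and det_le_exp_trace: "det Q \<le> det P * exp (trace (matrix_inv P ** Q) - CARD('n))"
proof -
  obtain T :: "real^'n^'n" and d where T: "transpose T ** P ** T = mat 1" and d: "transpose T ** Q ** T = diag_matrix d"
    using simultaneous_diagonalization[OF P pos_semidef_transpose[OF Q]] .
  have d0: "d i \<ge> 0" for i
    using pos_semidef_diagonal_nonneg[OF pos_semidef_congruence[OF Q, of T], of i]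
    by (simp add: d diag_matrix_nth_diag)
  have "trace (matrix_inv P ** Q) = trace (T ** (transpose T ** Q))"
    by (simp add: matrix_inv_of_congruence_to_identity[OF T] matrix_mul_assoc)
  also have "\<dots> = trace (transpose T ** Q ** T)" by (rule trace_mul_sym)
  finally have tr: "trace (matrix_inv P ** Q) = (\<Sum>i\<in>UNIV. d i)"
    by (simp add: d trace_diag_matrix)
  with d0 show "0 \<le> trace (matrix_inv P ** Q)" by (simp add: sum_nonneg)
  have "det (transpose T ** P ** T) = 1" by (simp add: T)
  then have detP: "det P * (det T)\<^sup>2 = 1"
    by (simp add: det_mul power2_eq_square mult_ac)
  then have "(det T)\<^sup>2 \<noteq> 0" by auto
  then have T2: "(det T)\<^sup>2 > 0" by simp
  with detP show Ppos: "0 < det P" by (metis zero_less_mult_pos2 zero_less_one)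
  have "det (transpose T ** Q ** T) = (\<Prod>i\<in>UNIV. d i)" by (simp add: d det_diag_matrix)
  then have detQ: "det Q * (det T)\<^sup>2 = (\<Prod>i\<in>UNIV. d i)"
    by (simp add: det_mul power2_eq_square mult_ac)
  have "(\<Prod>i\<in>UNIV. d i) \<le> (\<Prod>i\<in>UNIV. exp (d i - 1))"
    using d0 exp_ge_add_one_self[of "d _ - 1"] by (intro prod_mono) auto
  also have "\<dots> = exp (trace (matrix_inv P ** Q) - CARD('n))"
    by (simp add: exp_sum[symmetric] tr sum_subtractf)
  finally have "det Q * (det T)\<^sup>2 \<le> exp (trace (matrix_inv P ** Q) - CARD('n)) * (det P * (det T)\<^sup>2)"
    by (simp add: detQ detP)
  then show "det Q \<le> det P * exp (trace (matrix_inv P ** Q) - CARD('n))"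
    using T2 by (simp add: mult_ac)
qed

lemma trace_pos_def_mult_nonneg:
  fixes C Z :: "real^'n^'n"
  assumes "pos_def C" "pos_semidef Z"
  shows "0 \<le> trace (C ** Z)"
  using trace_matrix_inv_mult_nonneg[OF pos_def_matrix_inv[OF assms(1)] assms(2)] assms(1)
  by (simp add: matrix_inv_matrix_inv pos_def_invertible)

section \<open>The concave map \<open>N \<mapsto> (N\<^sup>-\<^sup>1 + \<Delta>)\<^sup>-\<^sup>1\<close>\<close>

text \<open>For invertible \<open>\<Delta>\<close> and \<open>N\<close> this is the parallel sum of
  \<open>N\<close> and the inverse of \<open>\<Delta>\<close>. It is the contribution of one group
  to the precision, up to the factor \<open>n i * m i\<close>.\<close>

abbreviation shrink :: "real^'n^'n \<Rightarrow> real^'n^'n \<Rightarrow> real^'n^'n" where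
  "shrink \<Delta> N \<equiv> matrix_inv (matrix_inv N + \<Delta>)"

text \<open>Everything follows from \<open>B\<close> being a two-sided inverse of
  \<open>matrix_inv N + \<Delta>\<close>, multiplied by \<open>B\<close> or \<open>N\<close> on a
  suitable side; \<open>\<Delta>\<close> is never inverted.\<close>

lemma
  fixes N \<Delta> :: "real^'n^'n"
  assumes N: "pos_def N" and \<Delta>: "pos_semidef \<Delta>"
  defines "B \<equiv> shrink \<Delta> N"
  shows pos_def_shrink: "pos_def B"
    and shrink_split: "B = B ** matrix_inv N ** B + B ** \<Delta> ** B"
    and shrink_eq_diff_left: "N ** \<Delta> ** B = N - B"
    and shrink_eq_diff_right: "B ** \<Delta> ** N = N - B"
    and mat_1_diff_mult_shrink: "mat 1 - \<Delta> ** B = matrix_inv N ** B"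
proof -
  have invN: "invertible N" using N by (rule pos_def_invertible)
  have pd: "pos_def (matrix_inv N + \<Delta>)"
    using N \<Delta> by (intro pos_def_add_pos_semidef pos_def_matrix_inv)
  then show "pos_def B" unfolding B_def by (rule pos_def_matrix_inv)
  from pd have "invertible (matrix_inv N + \<Delta>)" by (rule pos_def_invertible)
  from matrix_inv_left[OF this] matrix_inv_right[OF this]
  have B: "B ** matrix_inv N + B ** \<Delta> = mat 1" "matrix_inv N ** B + \<Delta> ** B = mat 1"
    by (simp_all add: B_def matrix_mult_bilinear)
  from B(2) show "mat 1 - \<Delta> ** B = matrix_inv N ** B" by (simp add: algebra_simps)
  have "(B ** matrix_inv N + B ** \<Delta>) ** B = B" by (simp add: B)
  then show "B = B ** matrix_inv N ** B + B ** \<Delta> ** B" by (simp add: matrix_mult_bilinear)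
  have "N ** (matrix_inv N ** B + \<Delta> ** B) = N" by (simp add: B)
  then show "N ** \<Delta> ** B = N - B"
    by (simp add: matrix_mult_bilinear matrix_mul_assoc matrix_inv_right[OF invN] algebra_simps)
  have "(B ** matrix_inv N + B ** \<Delta>) ** N = N" by (simp add: B)
  then show "B ** \<Delta> ** N = N - B"
    by (simp add: matrix_mult_bilinear matrix_mul_assoc[symmetric] matrix_inv_left[OF invN] algebra_simps)
qed

text \<open>Completing the square: the matrix below is \<open>(A - B)\<^sup>T (\<Delta> N \<Delta> + \<Delta>) (A - B)\<close> with
  \<open>B = shrink \<Delta> N\<close>. Unlike a form involving \<open>\<Delta>\<^sup>-\<^sup>1\<close>, this allows a singular \<open>\<Delta>\<close>.\<close>

lemma shrink_variational:
  fixes N \<Delta> A :: "real^'n^'n"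
  assumes N: "pos_def N" and \<Delta>: "pos_semidef \<Delta>" and A: "transpose A = A"
  defines "L \<equiv> mat 1 - \<Delta> ** A"
  shows "pos_semidef (transpose L ** N ** L + A ** \<Delta> ** A - shrink \<Delta> N)"
proof -
  define B where "B = shrink \<Delta> N"
  define W where "W = \<Delta> ** N ** \<Delta> + \<Delta>"
  have l: "N ** \<Delta> ** B = N - B" and r: "B ** \<Delta> ** N = N - B"
    using shrink_eq_diff_left[OF N \<Delta>] shrink_eq_diff_right[OF N \<Delta>] by (simp_all add: B_def)
  have B: "transpose B = B" using pos_def_shrink[OF N \<Delta>] by (simp add: B_def pos_def_transpose)
  have \<Delta>t: "transpose \<Delta> = \<Delta>" using \<Delta> by (rule pos_semidef_transpose)
  have "W = transpose \<Delta> ** N ** \<Delta> + \<Delta>" by (simp add: W_def \<Delta>t)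
  then have "pos_semidef W"
    using N \<Delta> by (simp only: pos_semidef_add pos_semidef_congruence pos_def_imp_pos_semidef)
  \<comment> \<open>The cross terms of the square lose \<open>B\<close> because
    \<open>N ** \<Delta> ** B = N - B\<close>. Hence \<open>B\<close> survives only in the last
    term, where it appears as \<open>N - B\<close>.\<close>
  have "W ** B = \<Delta> ** (N ** \<Delta> ** B) + \<Delta> ** B"
    by (simp add: W_def matrix_mult_bilinear matrix_mul_assoc)
  then have WB: "W ** B = \<Delta> ** N" by (simp add: l matrix_mult_bilinear)
  have "B ** W = (B ** \<Delta> ** N) ** \<Delta> + B ** \<Delta>"
    by (simp add: W_def matrix_mult_bilinear matrix_mul_assoc)
  then have BW: "B ** W = N ** \<Delta>" by (simp add: r matrix_mult_bilinear)
  have BWB: "B ** W ** B = N - B" by (simp add: BW l)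
  have "transpose (A - B) ** W ** (A - B) = A ** W ** A - A ** (W ** B) - B ** W ** A + B ** W ** B"
    by (simp add: transpose_linear A B matrix_mult_bilinear matrix_mul_assoc)
  also have "\<dots> = A ** W ** A - A ** \<Delta> ** N - N ** \<Delta> ** A + (N - B)"
    unfolding BWB unfolding WB BW by (simp add: matrix_mul_assoc)
  also have "\<dots> = transpose L ** N ** L + A ** \<Delta> ** A - B"
    by (simp add: L_def W_def transpose_linear matrix_transpose_mul A \<Delta>t matrix_mult_bilinear
        matrix_mul_assoc)
  finally show ?thesis
    using pos_semidef_congruence[OF \<open>pos_semidef W\<close>, of "A - B"] by (simp add: B_def)
qed

text \<open>The gradient at \<open>M\<close> of the map sending \<open>N\<close> to
  \<open>trace (C ** shrink \<Delta> N)\<close>, with \<open>C\<close> held fixed.\<close>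

abbreviation sensitivity :: "real^'n^'n \<Rightarrow> real^'n^'n \<Rightarrow> real^'n^'n \<Rightarrow> real^'n^'n" where
  "sensitivity C \<Delta> M \<equiv> matrix_inv M ** shrink \<Delta> M ** C ** shrink \<Delta> M ** matrix_inv M"

text \<open>Take \<open>A = shrink \<Delta> M\<close> in \<open>shrink_variational\<close>. Then
  \<open>L = matrix_inv M ** A\<close>, and the affine upper bound equals \<open>A\<close> at
  \<open>N = M\<close>. Taking the trace against a positive definite \<open>C\<close> preserves the
  matrix inequality.\<close>

lemma trace_shrink_le_tangent:
  fixes M N \<Delta> C :: "real^'n^'n"
  assumes M: "pos_def M" and N: "pos_def N" and \<Delta>: "pos_semidef \<Delta>" and C: "pos_def C"
  shows "trace (C ** shrink \<Delta> N) \<le> trace (C ** shrink \<Delta> M) + trace (sensitivity C \<Delta> M ** (N - M))"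
proof -
  define A where "A = shrink \<Delta> M"
  have A: "transpose A = A" using pos_def_shrink[OF M \<Delta>] by (simp add: A_def pos_def_transpose)
  define L where "L = matrix_inv M ** A"
  have L1: "mat 1 - \<Delta> ** A = L"
    using mat_1_diff_mult_shrink[OF M \<Delta>] by (simp add: A_def L_def)
  have invM: "invertible M" using M by (rule pos_def_invertible)
  have Lt: "transpose L = A ** matrix_inv M"
    by (simp add: L_def matrix_transpose_mul A transpose_matrix_inv invM pos_def_transpose[OF M])
  have "transpose L ** M ** L = A ** (matrix_inv M ** M) ** L"
    by (simp add: Lt matrix_mul_assoc)
  then have LML: "transpose L ** M ** L = A ** matrix_inv M ** A"
    by (simp add: matrix_inv_left invM) (simp add: L_def matrix_mul_assoc)
  \<comment> \<open>Cyclicity of the trace turns the increment of the affine bound into a pairing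
    with the gradient.\<close>
  have tr: "trace (C ** (transpose L ** Z ** L)) = trace (sensitivity C \<Delta> M ** Z)" for Z
  proof -
    have "trace (C ** (transpose L ** Z ** L)) = trace ((C ** transpose L ** Z) ** L)"
      by (simp add: matrix_mul_assoc)
    also have "\<dots> = trace (L ** (C ** transpose L ** Z))" by (rule trace_mul_sym)
    finally show ?thesis unfolding Lt by (simp add: A_def L_def matrix_mul_assoc)
  qed
  have "0 \<le> trace (C ** (transpose L ** N ** L + A ** \<Delta> ** A - shrink \<Delta> N))"
    using trace_pos_def_mult_nonneg[OF C shrink_variational[OF N \<Delta> A]] by (simp add: L1)
  also have "transpose L ** N ** L + A ** \<Delta> ** A = transpose L ** (N - M) ** L + A"
    using shrink_split[OF M \<Delta>, folded A_def] by (simp add: matrix_mult_bilinear LML algebra_simps)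
  finally show ?thesis
    by (simp add: matrix_mult_bilinear trace_linear tr A_def[symmetric])
qed

section \<open>Both directions of the equivalence for positive definite matrices, without
  designs\<close>

locale shrink_sum =
  fixes I :: "'i set" and c :: "'i \<Rightarrow> real" and \<Delta> M :: "'i \<Rightarrow> real^'n^'n"
  assumes finite_I: "finite I" and I_ne: "I \<noteq> {}"
    and c_pos: "i \<in> I \<Longrightarrow> 0 < c i"
    and \<Delta>: "i \<in> I \<Longrightarrow> pos_semidef (\<Delta> i)"
    and M: "i \<in> I \<Longrightarrow> pos_def (M i)"
begin

text \<open>The family is an argument, not the fixed \<open>M\<close>, because tangents are also
  taken at perturbed families.\<close>

definition precision :: "('i \<Rightarrow> real^'n^'n) \<Rightarrow> real^'n^'n" where
  "precision N = (\<Sum>i\<in>I. c i *\<^sub>R shrink (\<Delta> i) (N i))"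

abbreviation "cov N \<equiv> matrix_inv (precision N)"

lemma pos_def_precision: "(\<And>i. i \<in> I \<Longrightarrow> pos_def (N i)) \<Longrightarrow> pos_def (precision N)"
  unfolding precision_def
  by (intro pos_def_sum finite_I I_ne pos_def_scaleR c_pos pos_def_shrink \<Delta>)

lemma trace_cov_precision:
  "(\<And>i. i \<in> I \<Longrightarrow> pos_def (N i)) \<Longrightarrow> trace (cov N ** precision N) = CARD('n)"
  by (simp add: matrix_inv_left pos_def_invertible pos_def_precision trace_I)

text \<open>The left side is the exponent in \<open>det_le_exp_trace\<close>. As
  \<open>trace (cov N ** precision N)\<close> is the dimension, it is a difference of two traces
  against the same matrix \<open>cov N\<close>, and the tangent bound applies group by
  group.\<close>

lemma trace_precision_le_tangent:
  assumes N: "\<And>i. i \<in> I \<Longrightarrow> pos_def (N i)" and N': "\<And>i. i \<in> I \<Longrightarrow> pos_def (N' i)"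
  shows "trace (cov N ** precision N') - CARD('n) \<le>
    (\<Sum>i\<in>I. c i * trace (sensitivity (cov N) (\<Delta> i) (N i) ** (N' i - N i)))"
proof -
  have C: "pos_def (cov N)" by (intro pos_def_matrix_inv pos_def_precision N)
  have tr: "trace (cov N ** precision K) = (\<Sum>i\<in>I. c i * trace (cov N ** shrink (\<Delta> i) (K i)))" for K
    unfolding precision_def[of K] by (simp add: matrix_mult_bilinear trace_linear)
  have "trace (cov N ** precision N') - CARD('n) =
      trace (cov N ** precision N') - trace (cov N ** precision N)"
    by (simp add: trace_cov_precision N)
  also have "\<dots> = (\<Sum>i\<in>I. c i * (trace (cov N ** shrink (\<Delta> i) (N' i)) - trace (cov N ** shrink (\<Delta> i) (N i))))"
    unfolding tr by (simp add: sum_subtractf algebra_simps)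
  also have "\<dots> \<le> (\<Sum>i\<in>I. c i * trace (sensitivity (cov N) (\<Delta> i) (N i) ** (N' i - N i)))"
    using trace_shrink_le_tangent[OF N N' \<Delta> C] c_pos
    by (intro sum_mono mult_left_mono) (auto simp: less_imp_le algebra_simps)
  finally show ?thesis .
qed

text \<open>With the tangent taken at \<open>M\<close>, the hypothesis makes the exponent in the
  determinant bound nonpositive.\<close>

lemma det_precision_le:
  assumes N: "\<And>i. i \<in> I \<Longrightarrow> pos_def (N i)"
    and le: "\<And>i. i \<in> I \<Longrightarrow> trace (sensitivity (cov M) (\<Delta> i) (M i) ** N i)
      \<le> trace (sensitivity (cov M) (\<Delta> i) (M i) ** M i)"
  shows "det (precision N) \<le> det (precision M)"
proof -
  have PM: "pos_def (precision M)" and PN: "pos_def (precision N)"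
    by (intro pos_def_precision M N; assumption)+
  have "(\<Sum>i\<in>I. c i * trace (sensitivity (cov M) (\<Delta> i) (M i) ** (N i - M i))) \<le> 0"
    using le c_pos
    by (intro sum_nonpos mult_nonneg_nonpos)
      (auto simp: less_imp_le matrix_mult_bilinear trace_linear)
  then have "trace (cov M ** precision N) - CARD('n) \<le> 0"
    using trace_precision_le_tangent[of M N] M N by fastforce
  then have "exp (trace (cov M ** precision N) - CARD('n)) \<le> 1" by simp
  then have "det (precision M) * exp (trace (cov M ** precision N) - CARD('n)) \<le> det (precision M)"
    using det_pos_def[OF PM pos_semidef_0] by (simp add: mult_le_cancel_left1)
  with det_le_exp_trace[OF PM pos_def_imp_pos_semidef[OF PN]] show ?thesis by linarith
qed

text \<open>Perturbing \<open>M j\<close> to \<open>(1 - t) M j + t Z\<close> must not increase the determinant. The tangent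
  inequality at the perturbed point, evaluated at \<open>M\<close>, gives a one-sided estimate that can be
  divided by \<open>t\<close>; the limit \<open>t \<rightarrow> 0\<close> then only needs continuity, no derivative.\<close>

lemma sensitivity_le_of_det_precision_le:
  fixes Z :: "real^'n^'n"
  assumes j: "j \<in> I" and Z: "pos_semidef Z"
  defines "Mt \<equiv> \<lambda>t. M(j := (1 - t) *\<^sub>R M j + t *\<^sub>R Z)"
  assumes opt: "\<And>t. 0 < t \<Longrightarrow> t < 1 \<Longrightarrow> det (precision (Mt t)) \<le> det (precision M)"
  shows "trace (sensitivity (cov M) (\<Delta> j) (M j) ** Z) \<le> trace (sensitivity (cov M) (\<Delta> j) (M j) ** M j)"
proof -
  define g where "g t = trace (sensitivity (cov (Mt t)) (\<Delta> j) (Mt t j) ** (M j - Z))" for t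
  have Mt_j: "Mt t j = (1 - t) *\<^sub>R M j + t *\<^sub>R Z" and Mt_other: "i \<noteq> j \<Longrightarrow> Mt t i = M i" for t i
    by (simp_all add: Mt_def)
  \<comment> \<open>Since \<open>Z\<close> is only semidefinite, definiteness comes from the factor
    \<open>1 - t\<close> of \<open>M j\<close> being positive.\<close>
  have Mt_pd: "pos_def (Mt t i)" if "0 < t" "t < 1" "i \<in> I" for t i
    using that M Z j
    by (cases "i = j") (auto simp: Mt_j Mt_other intro!: pos_def_add_pos_semidef pos_def_scaleR pos_semidef_scaleR)
  have g_nonneg: "0 \<le> g t" if t: "0 < t" "t < 1" for t
  proof -
    have Pt: "pos_def (precision (Mt t))" and P: "pos_def (precision M)"
      using Mt_pd[OF t] M by (auto intro: pos_def_precision)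
    have "det (precision M) \<le> det (precision (Mt t)) * exp (trace (cov (Mt t) ** precision M) - CARD('n))"
      by (rule det_le_exp_trace[OF Pt pos_def_imp_pos_semidef[OF P]])
    \<comment> \<open>The determinant at the perturbed family is at most the one at
      \<open>M\<close>, so the exponential factor is at least 1 and its exponent is
      nonnegative.\<close>
    then have "det (precision (Mt t)) * 1 \<le>
        det (precision (Mt t)) * exp (trace (cov (Mt t) ** precision M) - CARD('n))"
      using opt[OF t] by linarith
    then have "0 \<le> trace (cov (Mt t) ** precision M) - CARD('n)"
      using det_pos_def[OF Pt pos_semidef_0] by (simp add: mult_le_cancel_left_pos)
    also have "\<dots> \<le> (\<Sum>i\<in>I. c i * trace (sensitivity (cov (Mt t)) (\<Delta> i) (Mt t i) ** (M i - Mt t i)))"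
      using Mt_pd[OF t] M by (intro trace_precision_le_tangent)
    \<comment> \<open>All groups other than \<open>j\<close> are unperturbed and contribute
      0.\<close>
    also have "\<dots> = c j * trace (sensitivity (cov (Mt t)) (\<Delta> j) (Mt t j) ** (M j - Mt t j))"
      using finite_I j
      by (subst sum.remove[of _ j]) (auto simp: Mt_other matrix_mult_bilinear trace_linear intro!: sum.neutral)
    also have "M j - Mt t j = t *\<^sub>R (M j - Z)" by (simp add: Mt_j algebra_simps)
    also have "c j * trace (sensitivity (cov (Mt t)) (\<Delta> j) (Mt t j) ** (t *\<^sub>R (M j - Z))) = (c j * t) * g t"
      by (simp add: g_def matrix_mult_bilinear trace_linear)
    finally show ?thesis
      using mult_pos_pos[OF c_pos[OF j] \<open>0 < t\<close>] by (simp add: zero_le_mult_iff)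
  qed
  have Mt_lim: "((\<lambda>t. Mt t i) \<longlongrightarrow> M i) (at_right 0)" for i
  proof (cases "i = j")
    case True
    have "((\<lambda>t. (1 - t) *\<^sub>R M j + t *\<^sub>R Z) \<longlongrightarrow> (1 - 0) *\<^sub>R M j + 0 *\<^sub>R Z) (at_right 0)"
      by (intro tendsto_intros)
    then show ?thesis by (simp add: True Mt_j)
  qed (simp add: Mt_other)
  have shrink_lim: "((\<lambda>t. shrink (\<Delta> i) (Mt t i)) \<longlongrightarrow> shrink (\<Delta> i) (M i)) (at_right 0)" if "i \<in> I" for i
    by (intro tendsto_matrix_inv tendsto_add tendsto_const Mt_lim pos_def_invertible M that
        pos_def_add_pos_semidef pos_def_matrix_inv \<Delta>)
  have cov_lim: "((\<lambda>t. cov (Mt t)) \<longlongrightarrow> cov M) (at_right 0)"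
    unfolding precision_def
    by (intro tendsto_matrix_inv tendsto_sum tendsto_scaleR tendsto_const shrink_lim
        pos_def_invertible pos_def_precision[unfolded precision_def] M)
  have "(g \<longlongrightarrow> trace (sensitivity (cov M) (\<Delta> j) (M j) ** (M j - Z))) (at_right 0)"
    unfolding g_def
    by (intro bounded_linear.tendsto[OF bounded_linear_trace] tendsto_matrix_mult tendsto_const
        tendsto_matrix_inv[OF Mt_lim] shrink_lim cov_lim j pos_def_invertible M)
  moreover have "eventually (\<lambda>t. 0 \<le> g t) (at_right 0)"
    unfolding eventually_at_right_field using g_nonneg by (intro exI[of _ 1]) auto
  ultimately have "0 \<le> trace (sensitivity (cov M) (\<Delta> j) (M j) ** (M j - Z))"
    by (intro tendsto_lowerbound) auto
  then show ?thesis by (simp add: matrix_mult_bilinear trace_linear)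
qed

end

section \<open>Designs\<close>

lemma pos_semidef_info_matrix:
  assumes "approx_design X \<zeta>"
  shows "pos_semidef (info_matrix \<Sigma> G \<zeta>)"
  unfolding info_matrix_def
  using assms by (intro pos_semidef_sum pos_semidef_scaleR pos_semidef_gram) (auto simp: approx_design_def)

lemma trace_mult_gram: "trace (W ** (transpose H ** H)) = trace (H ** W ** transpose H)"
  for W :: "real^'p^'p" and H :: "real^'p^'l"
  using trace_mul_sym[of "W ** transpose H" H] by (simp add: matrix_mul_assoc)

lemma trace_mult_info_matrix:
  "trace (W ** info_matrix \<Sigma> G \<zeta>) =
    (\<Sum>x\<in>points \<zeta>. weight \<zeta> x * trace (std_regr \<Sigma> G x ** W ** transpose (std_regr \<Sigma> G x)))"
  by (simp add: info_matrix_def matrix_mult_bilinear trace_linear trace_mult_gram)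

text \<open>The point \<open>x\<close> may or may not belong to \<open>\<zeta>\<close> already.
  Outside \<open>points \<zeta>\<close> the weight function is arbitrary, so it is reset to 0 there
  before weight is added at \<open>x\<close>.\<close>

definition mix_design :: "real \<Rightarrow> 'x \<Rightarrow> 'x design \<Rightarrow> 'x design" where
  "mix_design t x \<zeta> = Design (insert x (points \<zeta>))
     (\<lambda>y. (1 - t) * (if y \<in> points \<zeta> then weight \<zeta> y else 0) + t * (if y = x then 1 else 0))"

text \<open>Stated for vector-valued \<open>f\<close> to serve twice: Gram matrices give the
  information matrix, the constant 1 gives the total weight.\<close>

lemma sum_mix_design:
  fixes f :: "'x \<Rightarrow> 'v::real_vector"
  assumes "finite (points \<zeta>)"
  shows "(\<Sum>y\<in>points (mix_design t x \<zeta>). weight (mix_design t x \<zeta>) y *\<^sub>R f y) =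
    (1 - t) *\<^sub>R (\<Sum>y\<in>points \<zeta>. weight \<zeta> y *\<^sub>R f y) + t *\<^sub>R f x"
proof -
  have "(\<Sum>y\<in>insert x (points \<zeta>). (if y \<in> points \<zeta> then weight \<zeta> y else 0) *\<^sub>R f y) =
      (\<Sum>y\<in>points \<zeta>. weight \<zeta> y *\<^sub>R f y)"
    using assms by (intro sum.mono_neutral_cong_right) auto
  moreover have "(\<Sum>y\<in>insert x (points \<zeta>). (if y = x then 1 else 0) *\<^sub>R f y) = f x"
    using assms by (subst sum.mono_neutral_right[of _ "{x}"]) auto
  ultimately show ?thesis
    by (simp add: mix_design_def scaleR_add_left sum.distrib scaleR_scaleR[symmetric]
        scaleR_sum_right[symmetric] del: scaleR_scaleR)
qed

lemma info_matrix_mix_design: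
  "finite (points \<zeta>) \<Longrightarrow> info_matrix \<Sigma> G (mix_design t x \<zeta>) =
    (1 - t) *\<^sub>R info_matrix \<Sigma> G \<zeta> + t *\<^sub>R (transpose (std_regr \<Sigma> G x) ** std_regr \<Sigma> G x)"
  unfolding info_matrix_def by (rule sum_mix_design)

lemma approx_design_mix_design:
  assumes \<zeta>: "approx_design X \<zeta>" and x: "x \<in> X" and t: "0 < t" "t < 1"
  shows "approx_design X (mix_design t x \<zeta>)"
  using assms sum_mix_design[of \<zeta> t x "\<lambda>_. 1 :: real"]
  by (auto simp: approx_design_def) (auto simp: mix_design_def)

section \<open>The equivalence theorem: transfer from matrices back to designs\<close>

theorem theorem4:
  fixes s :: nat
    and n m :: "nat \<Rightarrow> nat"
    and X :: "nat \<Rightarrow> 'x set"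
    and G :: "nat \<Rightarrow> 'x \<Rightarrow> real^'p^'l"
    and D :: "nat \<Rightarrow> real^'p^'p"
    and \<Sigma> :: "nat \<Rightarrow> real^'l^'l"
    and \<xi> :: "nat \<Rightarrow> 'x design"
    and Gt :: "nat \<Rightarrow> 'x \<Rightarrow> real^'p^'l"
    and Minv A :: "nat \<Rightarrow> real^'p^'p"
    and C :: "real^'p^'p"
  assumes "1 \<le> s"
    and "\<And>i. i \<in> {1..s} \<Longrightarrow> 0 < n i"
    and "\<And>i. i \<in> {1..s} \<Longrightarrow> 0 < m i"
    and "\<And>i. i \<in> {1..s} \<Longrightarrow> pos_semidef (D i)"
    and "\<And>i. i \<in> {1..s} \<Longrightarrow> pos_semidef (\<Sigma> i) \<and> invertible (\<Sigma> i)"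
    and "admissible s X G \<Sigma> \<xi>"
    and Gt: "Gt = (\<lambda>i. std_regr (\<Sigma> i) (G i))"
    and Minv: "Minv = (\<lambda>i. matrix_inv (info_matrix (\<Sigma> i) (G i) (\<xi> i)))"
    and A: "A = (\<lambda>i. matrix_inv (Minv i + real (m i) *\<^sub>R D i))"
    and C: "C = matrix_inv (\<Sum>r=1..s. real (n r * m r) *\<^sub>R matrix_inv (Minv r + real (m r) *\<^sub>R D r))"
  shows "(D_optimal s n m X G D \<Sigma> \<xi> \<longleftrightarrow>
           (\<forall>i\<in>{1..s}. \<forall>x\<in>X i.
              trace (Gt i x ** (Minv i ** A i ** C ** A i ** Minv i) ** transpose (Gt i x))
              \<le> trace (Minv i ** A i ** C ** A i))) \<and>
         (D_optimal s n m X G D \<Sigma> \<xi> \<longrightarrow>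
           (\<forall>i\<in>{1..s}. \<forall>x\<in>support_points (\<xi> i).
              trace (Gt i x ** (Minv i ** A i ** C ** A i ** Minv i) ** transpose (Gt i x))
              = trace (Minv i ** A i ** C ** A i)))"
proof -
  define H where "H \<zeta> i = info_matrix (\<Sigma> i) (G i) (\<zeta> i)" for \<zeta> :: "nat \<Rightarrow> 'x design" and i
  define \<Delta> where "\<Delta> i = real (m i) *\<^sub>R D i" for i
  define c where "c i = real (n i * m i)" for i
  define ineq_lhs where "ineq_lhs i x =
    trace (Gt i x ** (Minv i ** A i ** C ** A i ** Minv i) ** transpose (Gt i x))" for i x
  define ineq_rhs where "ineq_rhs i = trace (Minv i ** A i ** C ** A i)" for i
  \<comment> \<open>Information matrices are always semidefinite; admissibility adds
    invertibility.\<close>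
  have H_pd: "pos_def (H \<zeta> i)" if "admissible s X G \<Sigma> \<zeta>" "i \<in> {1..s}" for \<zeta> i
    using that pos_semidef_info_matrix pos_semidef_invertible_imp_pos_def
    unfolding H_def admissible_def by blast
  note M_pd = H_pd[OF \<open>admissible s X G \<Sigma> \<xi>\<close>]
  interpret shrink_sum "{1..s}" c \<Delta> "H \<xi>"
    using assms(1-4) M_pd by unfold_locales (auto simp: c_def \<Delta>_def pos_semidef_scaleR)
  have C_eq: "C = cov (H \<xi>)"
    by (simp add: C precision_def Minv c_def \<Delta>_def H_def del: One_nat_def)
  define W where "W i = sensitivity C (\<Delta> i) (H \<xi> i)" for i
  have W_eq: "W i = Minv i ** A i ** C ** A i ** Minv i" for i
    by (simp add: W_def A Minv H_def \<Delta>_def)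
  have W_info: "trace (W i ** H \<zeta> i) = (\<Sum>x\<in>points (\<zeta> i). weight (\<zeta> i) x * ineq_lhs i x)" for \<zeta> i
    unfolding H_def trace_mult_info_matrix by (simp add: ineq_lhs_def W_eq Gt)
  \<comment> \<open>Together with \<open>W_info\<close>, this identifies the right side of the
    condition as the average of its left side over \<open>\<xi> i\<close> itself.\<close>
  have W_rhs: "trace (W i ** H \<xi> i) = ineq_rhs i" if "i \<in> {1..s}" for i
  proof -
    have "Minv i ** H \<xi> i = mat 1"
      using M_pd[OF that] by (simp add: Minv H_def matrix_inv_left pos_def_invertible)
    then show ?thesis by (simp add: W_eq ineq_rhs_def matrix_mul_assoc[symmetric])
  qed
  have crit: "D_criterion s n m G D \<Sigma> \<zeta> = - ln (det (precision (H \<zeta>)))" for \<zeta>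
    by (simp add: D_criterion_def blue_precision_def group_precision_def precision_def c_def \<Delta>_def H_def
        del: One_nat_def)
  have det_pos: "0 < det (precision (H \<zeta>))" if "admissible s X G \<Sigma> \<zeta>" for \<zeta>
    using pos_def_precision[of "H \<zeta>"] H_pd[OF that] det_pos_def pos_semidef_0 by blast
  \<comment> \<open>The determinants are positive, so the logarithm can be removed by
    monotonicity.\<close>
  have opt_iff: "D_optimal s n m X G D \<Sigma> \<xi> \<longleftrightarrow>
      (\<forall>\<eta>. admissible s X G \<Sigma> \<eta> \<longrightarrow> det (precision (H \<eta>)) \<le> det (precision (H \<xi>)))"
    unfolding D_optimal_def crit using \<open>admissible s X G \<Sigma> \<xi>\<close> det_pos by auto

  have sufficient: "D_optimal s n m X G D \<Sigma> \<xi>" if le: "\<forall>i\<in>{1..s}. \<forall>x\<in>X i. ineq_lhs i x \<le> ineq_rhs i"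
    unfolding opt_iff
  proof (intro allI impI det_precision_le)
    fix \<eta> i
    assume \<eta>: "admissible s X G \<Sigma> \<eta>" and i: "i \<in> {1..s}"
    show "pos_def (H \<eta> i)" using \<eta> i by (rule H_pd)
    have d: "approx_design (X i) (\<eta> i)" using \<eta> i by (simp add: admissible_def)
    have "trace (W i ** H \<eta> i) \<le> (\<Sum>x\<in>points (\<eta> i). weight (\<eta> i) x * ineq_rhs i)"
      unfolding W_info using d le i
      by (intro sum_mono mult_left_mono) (auto simp: approx_design_def)
    also have "\<dots> = trace (W i ** H \<xi> i)"
      using d by (simp add: sum_distrib_right[symmetric] approx_design_def W_rhs[OF i])
    finally show "trace (sensitivity (cov (H \<xi>)) (\<Delta> i) (H \<xi> i) ** H \<eta> i)
        \<le> trace (sensitivity (cov (H \<xi>)) (\<Delta> i) (H \<xi> i) ** H \<xi> i)"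
      by (simp add: W_def C_eq)
  qed

  have necessary: "ineq_lhs i x \<le> ineq_rhs i"
    if opt: "D_optimal s n m X G D \<Sigma> \<xi>" and i: "i \<in> {1..s}" and x: "x \<in> X i" for i x
  proof -
    define Z where "Z = transpose (Gt i x) ** Gt i x"
    have d: "approx_design (X i) (\<xi> i)" using \<open>admissible s X G \<Sigma> \<xi>\<close> i by (simp add: admissible_def)
    have "trace (sensitivity (cov (H \<xi>)) (\<Delta> i) (H \<xi> i) ** Z)
        \<le> trace (sensitivity (cov (H \<xi>)) (\<Delta> i) (H \<xi> i) ** H \<xi> i)"
    proof (rule sensitivity_le_of_det_precision_le[OF i])
      show "pos_semidef Z" unfolding Z_def by (rule pos_semidef_gram)
      fix t :: real assume t: "0 < t" "t < 1"
      \<comment> \<open>Only group \<open>i\<close> changes: a fraction \<open>t\<close> of its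
        weight moves to \<open>x\<close>, which realizes the matrix perturbation by an actual
        design.\<close>
      define \<eta> where "\<eta> = \<xi>(i := mix_design t x (\<xi> i))"
      have H\<eta>: "H \<eta> = (H \<xi>)(i := (1 - t) *\<^sub>R H \<xi> i + t *\<^sub>R Z)"
        using d by (auto simp: H_def \<eta>_def fun_eq_iff info_matrix_mix_design Z_def Gt approx_design_def)
      have "pos_def (H \<eta> i)"
        unfolding H\<eta> using t M_pd[OF i] pos_semidef_gram[of "Gt i x"]
        by (auto simp: Z_def intro!: pos_def_add_pos_semidef pos_def_scaleR pos_semidef_scaleR)
      then have "invertible (info_matrix (\<Sigma> i) (G i) (mix_design t x (\<xi> i)))"
        using pos_def_invertible by (fastforce simp: H_def \<eta>_def)
      then have "admissible s X G \<Sigma> \<eta>"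
        using \<open>admissible s X G \<Sigma> \<xi>\<close> approx_design_mix_design[OF d x t]
        by (auto simp: admissible_def \<eta>_def)
      then show "det (precision ((H \<xi>)(i := (1 - t) *\<^sub>R H \<xi> i + t *\<^sub>R Z))) \<le> det (precision (H \<xi>))"
        using opt unfolding opt_iff H\<eta>[symmetric] by blast
    qed
    moreover have "trace (W i ** Z) = ineq_lhs i x"
      by (simp add: Z_def trace_mult_gram ineq_lhs_def W_eq)
    ultimately show ?thesis by (simp add: W_rhs[OF i, symmetric] W_def C_eq)
  qed

  have equality: "ineq_lhs i x = ineq_rhs i"
    if opt: "D_optimal s n m X G D \<Sigma> \<xi>" and i: "i \<in> {1..s}" and x: "x \<in> support_points (\<xi> i)" for i x
  proof -
    have d: "approx_design (X i) (\<xi> i)" using \<open>admissible s X G \<Sigma> \<xi>\<close> i by (simp add: admissible_def)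
    \<comment> \<open>The weighted gaps sum to 0 and are nonnegative by \<open>necessary\<close>, so
      each vanishes; at a support point the positive weight cancels.\<close>
    have "(\<Sum>y\<in>points (\<xi> i). weight (\<xi> i) y * (ineq_rhs i - ineq_lhs i y)) = ineq_rhs i - trace (W i ** H \<xi> i)"
      using d unfolding W_info
      by (simp add: right_diff_distrib sum_subtractf sum_distrib_right[symmetric] approx_design_def)
    also have "\<dots> = 0" by (simp add: W_rhs[OF i])
    finally have "(\<Sum>y\<in>points (\<xi> i). weight (\<xi> i) y * (ineq_rhs i - ineq_lhs i y)) = 0" .
    moreover have "0 \<le> weight (\<xi> i) y * (ineq_rhs i - ineq_lhs i y)" if "y \<in> points (\<xi> i)" for y
      using d that necessary[OF opt i, of y] by (auto simp: approx_design_def)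
    ultimately have "weight (\<xi> i) x * (ineq_rhs i - ineq_lhs i x) = 0"
      using d x by (subst (asm) sum_nonneg_eq_0_iff) (auto simp: approx_design_def support_points_def)
    with x show ?thesis by (simp add: support_points_def)
  qed

  show ?thesis
    unfolding ineq_lhs_def[symmetric] ineq_rhs_def[symmetric]
    using sufficient necessary equality by blast
qed

end
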